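(* Specifying a model of the theory $\mathbb{T}_{\mathbb{1}}$ of natural models admitting a unit type is equivalent to specifying a natural model $(\mathbb{C},p:\dot{\mathcal U}\to\mathcal U)$ together with elements $\widehat{\mathbb{1}}\in\mathcal{U}(\diamond)$ and $\widehat{\star}\in\dot{\mathcal{U}}(\diamond)$ such that the square in $\widehat{\mathbb{C}}$ with top $\widehat{\star}:\mathsf{y}(\diamond)\to\dot{\mathcal{U}}$, right $p$, left $\mathrm{id}_{\mathsf{y}(\diamond)}$ and bottom $\widehat{\mathbb{1}}:\mathsf{y}(\diamond)\to\mathcal{U}$ is a pullback. (The correspondence is $\widehat{\mathbb{1}}=\mathsf{unit}$, $\widehat{\star}=\mathsf{star}$.)
   Context: Write $\mathsf{y}$ for the Yoneda embedding of a small category $\mathbb{C}$ into $\widehat{\mathbb{C}}=\mathbf{Set}^{\mathbb{C}^{\mathrm{op}}}$; elements $x\in P(\Gamma)$ are identified with maps $x:\mathsf{y}(\Gamma)\to P$, and $x[\sigma]=P(\sigma)(x)$. A natural model $(\mathbb{C},p)$ consists of a small category $\mathbb{C}$ with a distinguished terminal object $\diamond$, presheaves $\mathcal{U},\dot{\mathcal{U}}$ on $\mathbb{C}$, a natural transformation $p:\dot{\mathcal{U}}\to\mathcal{U}$ and, for each object $\Gamma$ and $A\in\mathcal{U}(\Gamma)$, a chosen object $\Gamma\cdot A$, morphism $\mathsf{p}_A:\Gamma\cdot A\to\Gamma$ and element $\mathsf{q}_A\in\dot{\mathcal{U}}(\Gamma\cdot A)$ such that the square with top $\mathsf{q}_A$,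 right $p$, left $\mathsf{y}(\mathsf{p}_A)$, bottom $A$ is a pullback. Write $\mathsf{t}_\Gamma:\Gamma\to\diamond$ for the unique morphism. Natural models are exactly the models of an essentially algebraic theory $\mathbb{T}$ with sorts for contexts (objects of $\mathbb{C}$), substitutions (morphisms of $\mathbb C$), types (elements of the sets $\mathcal{U}(\Gamma)$) and terms (elements of the sets $\dot{\mathcal{U}}(\Gamma)$). The theory $\mathbb{T}_{\mathbb{1}}$ extends $\mathbb{T}$ by two constants $\mathsf{unit}$ (of sort types) and $\mathsf{star}$ (of sort terms) and the equations: (i) $\mathsf{unit}$ has context $\diamond$, i.e. $\mathsf{unit}\in\mathcal{U}(\diamond)$; (ii) $\mathsf{star}\in\dot{\mathcal{U}}(\diamond)$ with $p_\diamond(\mathsf{star})=\mathsf{unit}$; (iii) $\mathsf{p}_{\mathsf{unit}}=\mathsf{t}_{\diamond\cdot\mathsf{unit}}$; (iv) $\mathsf{q}_{\mathsf{unit}}=\mathsf{star}[\mathsf{t}_{\diamond\cdot\mathsf{unit}}]$. Thus a model of $\mathbb{T}_{\mathbb{1}}$ is a natural model with such a pair $(\mathsf{unit},\mathsf{star})$. *)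

theory Defs
  imports Main "HOL-Library.FuncSet"
begin

section \<open>Categories\<close>

record ('o, 'a) cat =
  Obj :: "'o set"
  Arr :: "'a set"
  Dom :: "'a \<Rightarrow> 'o"
  Cod :: "'a \<Rightarrow> 'o"
  Id :: "'o \<Rightarrow> 'a"
  Comp :: "'a \<Rightarrow> 'a \<Rightarrow> 'a"  \<comment> \<open>\<open>Comp C g f\<close> is $g \circ f$\<close>

definition Hom :: "('o, 'a) cat \<Rightarrow> 'o \<Rightarrow> 'o \<Rightarrow> 'a set" where
  "Hom C X Y = {f \<in> Arr C. Dom C f = X \<and> Cod C f = Y}"

locale category =
  fixes C :: "('o, 'a) cat"
  assumes Dom_Obj: "f \<in> Arr C \<Longrightarrow> Dom C f \<in> Obj C"
    and Cod_Obj: "f \<in> Arr C \<Longrightarrow> Cod C f \<in> Obj C"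
    and Id_Hom: "X \<in> Obj C \<Longrightarrow> Id C X \<in> Hom C X X"
    and Comp_Hom: "\<lbrakk>f \<in> Hom C X Y; g \<in> Hom C Y Z\<rbrakk> \<Longrightarrow> Comp C g f \<in> Hom C X Z"
    and Comp_Id: "f \<in> Hom C X Y \<Longrightarrow> Comp C f (Id C X) = f"
    and Id_Comp: "f \<in> Hom C X Y \<Longrightarrow> Comp C (Id C Y) f = f"
    and Comp_assoc: "\<lbrakk>f \<in> Hom C W X; g \<in> Hom C X Y; h \<in> Hom C Y Z\<rbrakk> \<Longrightarrow>
      Comp C (Comp C h g) f = Comp C h (Comp C g f)"

definition op_cat :: "('o, 'a) cat \<Rightarrow> ('o, 'a) cat" where
  "op_cat C = C\<lparr>Dom := Cod C, Cod := Dom C, Comp := (\<lambda>g f. Comp C f g)\<rparr>"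

definition is_terminal :: "('o, 'a) cat \<Rightarrow> 'o \<Rightarrow> bool" where
  "is_terminal C T \<longleftrightarrow> T \<in> Obj C \<and> (\<forall>X \<in> Obj C. \<exists>!f. f \<in> Hom C X T)"

text \<open>Argument order: top, right, left, bottom; \<open>t\<close> and \<open>l\<close> start at the pullback object,
  \<open>r\<close> and \<open>b\<close> end at the common codomain.\<close>

definition is_pullback :: "('o, 'a) cat \<Rightarrow> 'a \<Rightarrow> 'a \<Rightarrow> 'a \<Rightarrow> 'a \<Rightarrow> bool" where
  "is_pullback C t r l b \<longleftrightarrow>
    t \<in> Arr C \<and> r \<in> Arr C \<and> l \<in> Arr C \<and> b \<in> Arr C \<and>
    Dom C t = Dom C l \<and> Cod C t = Dom C r \<and> Cod C l = Dom C b \<and> Cod C r = Cod C b \<and>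
    Comp C r t = Comp C b l \<and>
    (\<forall>Q \<in> Obj C. \<forall>h \<in> Hom C Q (Dom C r). \<forall>k \<in> Hom C Q (Dom C b).
      Comp C r h = Comp C b k \<longrightarrow>
      (\<exists>!u. u \<in> Hom C Q (Dom C t) \<and> Comp C t u = h \<and> Comp C l u = k))"


section \<open>Sets, functors and presheaves\<close>

text \<open>An arrow given by an underlying map together with its source and target; used both for
  functions between sets and for natural transformations between functors.\<close>

datatype ('x, 'm) arrow = Arrow (src: 'x) (fn: 'm) (trg: 'x)

text \<open>The type \<open>'u\<close> plays the role of the universe of small sets: the category of sets has the
  subsets of \<open>'u\<close> as objects. Here and below, maps are extensional (\<open>undefined\<close> outside their
  domain), so that equality of arrows is equality of the mathematical maps.\<close>

definition Set_cat :: "('u set, ('u set, 'u \<Rightarrow> 'u) arrow) cat" where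
  "Set_cat = \<lparr>
    Obj = UNIV,
    Arr = {m. fn m \<in> src m \<rightarrow>\<^sub>E trg m},
    Dom = src,
    Cod = trg,
    Id = (\<lambda>X. Arrow X (\<lambda>x\<in>X. x) X),
    Comp = (\<lambda>g f. Arrow (src f) (\<lambda>x\<in>src f. fn g (fn f x)) (trg g))\<rparr>"

record ('o1, 'a1, 'o2, 'a2) fnctr =
  FObj :: "'o1 \<Rightarrow> 'o2"
  FArr :: "'a1 \<Rightarrow> 'a2"

definition is_functor ::
    "('o1, 'a1) cat \<Rightarrow> ('o2, 'a2) cat \<Rightarrow> ('o1, 'a1, 'o2, 'a2) fnctr \<Rightarrow> bool" where
  "is_functor A B F \<longleftrightarrow>
    FObj F \<in> Obj A \<rightarrow>\<^sub>E Obj B \<and>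
    FArr F \<in> Arr A \<rightarrow>\<^sub>E Arr B \<and>
    (\<forall>f \<in> Arr A. FArr F f \<in> Hom B (FObj F (Dom A f)) (FObj F (Cod A f))) \<and>
    (\<forall>X \<in> Obj A. FArr F (Id A X) = Id B (FObj F X)) \<and>
    (\<forall>f \<in> Arr A. \<forall>g \<in> Arr A. Cod A f = Dom A g \<longrightarrow>
      FArr F (Comp A g f) = Comp B (FArr F g) (FArr F f))"

type_synonym ('o1, 'a1, 'o2, 'a2) nat_trans =
  "(('o1, 'a1, 'o2, 'a2) fnctr, 'o1 \<Rightarrow> 'a2) arrow"

definition is_nat_trans ::
    "('o1, 'a1) cat \<Rightarrow> ('o2, 'a2) cat \<Rightarrow> ('o1, 'a1, 'o2, 'a2) nat_trans \<Rightarrow> bool" where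
  "is_nat_trans A B \<eta> \<longleftrightarrow>
    is_functor A B (src \<eta>) \<and> is_functor A B (trg \<eta>) \<and>
    fn \<eta> \<in> extensional (Obj A) \<and>
    (\<forall>X \<in> Obj A. fn \<eta> X \<in> Hom B (FObj (src \<eta>) X) (FObj (trg \<eta>) X)) \<and>
    (\<forall>f \<in> Arr A. Comp B (fn \<eta> (Cod A f)) (FArr (src \<eta>) f) =
                 Comp B (FArr (trg \<eta>) f) (fn \<eta> (Dom A f)))"

definition functor_cat :: "('o1, 'a1) cat \<Rightarrow> ('o2, 'a2) cat \<Rightarrow>
    (('o1, 'a1, 'o2, 'a2) fnctr, ('o1, 'a1, 'o2, 'a2) nat_trans) cat" where
  "functor_cat A B = \<lparr>
    Obj = {F. is_functor A B F},
    Arr = {\<eta>. is_nat_trans A B \<eta>},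
    Dom = src,
    Cod = trg,
    Id = (\<lambda>F. Arrow F (\<lambda>X\<in>Obj A. Id B (FObj F X)) F),
    Comp = (\<lambda>\<theta> \<eta>. Arrow (src \<eta>) (\<lambda>X\<in>Obj A. Comp B (fn \<theta> X) (fn \<eta> X)) (trg \<theta>))\<rparr>"

type_synonym ('o, 'u) presheaf = "('o, 'u, 'u set, ('u set, 'u \<Rightarrow> 'u) arrow) fnctr"
type_synonym ('o, 'u) presheaf_arr = "('o, 'u, 'u set, ('u set, 'u \<Rightarrow> 'u) arrow) nat_trans"

text \<open>A category is small relative to \<open>'u\<close> when its arrows form a subset of \<open>'u\<close>; then the
  representable presheaves below are presheaves of small sets.\<close>

definition PSh :: "('o, 'u) cat \<Rightarrow> (('o, 'u) presheaf, ('o, 'u) presheaf_arr) cat" where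
  "PSh C = functor_cat (op_cat C) Set_cat"

text \<open>\<open>restr P \<sigma> x\<close> is $x[\sigma] = P(\sigma)(x)$, and \<open>comp_at \<eta> \<Gamma>\<close> is the function $\eta_\Gamma$.\<close>

definition restr :: "('o, 'u) presheaf \<Rightarrow> 'u \<Rightarrow> 'u \<Rightarrow> 'u" where
  "restr P \<sigma> x = fn (FArr P \<sigma>) x"

definition comp_at :: "('o, 'u) presheaf_arr \<Rightarrow> 'o \<Rightarrow> 'u \<Rightarrow> 'u" where
  "comp_at \<eta> \<Gamma> x = fn (fn \<eta> \<Gamma>) x"

definition yon :: "('o, 'u) cat \<Rightarrow> 'o \<Rightarrow> ('o, 'u) presheaf" where
  "yon C \<Gamma> = \<lparr>
    FObj = (\<lambda>\<Delta>\<in>Obj C. Hom C \<Delta> \<Gamma>),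
    FArr = (\<lambda>\<sigma>\<in>Arr C.
      Arrow (Hom C (Cod C \<sigma>) \<Gamma>) (\<lambda>\<tau>\<in>Hom C (Cod C \<sigma>) \<Gamma>. Comp C \<tau> \<sigma>) (Hom C (Dom C \<sigma>) \<Gamma>))\<rparr>"

definition yon_arr :: "('o, 'u) cat \<Rightarrow> 'u \<Rightarrow> ('o, 'u) presheaf_arr" where
  "yon_arr C \<tau> = Arrow
    (yon C (Dom C \<tau>))
    (\<lambda>\<Delta>\<in>Obj C.
      Arrow (Hom C \<Delta> (Dom C \<tau>)) (\<lambda>\<sigma>\<in>Hom C \<Delta> (Dom C \<tau>). Comp C \<tau> \<sigma>) (Hom C \<Delta> (Cod C \<tau>)))
    (yon C (Cod C \<tau>))"

text \<open>The map $\mathsf{y}(\Gamma) \to P$ identified with an element $x \in P(\Gamma)$.\<close>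

definition yon_elem ::
    "('o, 'u) cat \<Rightarrow> ('o, 'u) presheaf \<Rightarrow> 'o \<Rightarrow> 'u \<Rightarrow> ('o, 'u) presheaf_arr" where
  "yon_elem C P \<Gamma> x = Arrow
    (yon C \<Gamma>)
    (\<lambda>\<Delta>\<in>Obj C. Arrow (Hom C \<Delta> \<Gamma>) (\<lambda>\<sigma>\<in>Hom C \<Delta> \<Gamma>. restr P \<sigma> x) (FObj P \<Delta>))
    P"


section \<open>Natural models\<close>

record ('o, 'u) nat_model =
  Ctx :: "('o, 'u) cat"
  emp :: 'o
  Ty :: "('o, 'u) presheaf"
  Tm :: "('o, 'u) presheaf"
  typing :: "('o, 'u) presheaf_arr"
  ext :: "'o \<Rightarrow> 'u \<Rightarrow> 'o"
  proj :: "'o \<Rightarrow> 'u \<Rightarrow> 'u"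
  var :: "'o \<Rightarrow> 'u \<Rightarrow> 'u"

locale natural_model =
  fixes M :: "('o, 'u) nat_model"
  assumes category_Ctx: "category (Ctx M)"
    and terminal_emp: "is_terminal (Ctx M) (emp M)"
    and typing_Hom: "typing M \<in> Hom (PSh (Ctx M)) (Tm M) (Ty M)"
    and ext_Obj: "\<lbrakk>\<Gamma> \<in> Obj (Ctx M); A \<in> FObj (Ty M) \<Gamma>\<rbrakk> \<Longrightarrow> ext M \<Gamma> A \<in> Obj (Ctx M)"
    and proj_Hom: "\<lbrakk>\<Gamma> \<in> Obj (Ctx M); A \<in> FObj (Ty M) \<Gamma>\<rbrakk> \<Longrightarrow>
      proj M \<Gamma> A \<in> Hom (Ctx M) (ext M \<Gamma> A) \<Gamma>"
    and var_elem: "\<lbrakk>\<Gamma> \<in> Obj (Ctx M); A \<in> FObj (Ty M) \<Gamma>\<rbrakk> \<Longrightarrow>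
      var M \<Gamma> A \<in> FObj (Tm M) (ext M \<Gamma> A)"
    and ext_pullback: "\<lbrakk>\<Gamma> \<in> Obj (Ctx M); A \<in> FObj (Ty M) \<Gamma>\<rbrakk> \<Longrightarrow>
      is_pullback (PSh (Ctx M))
        (yon_elem (Ctx M) (Tm M) (ext M \<Gamma> A) (var M \<Gamma> A))
        (typing M)
        (yon_arr (Ctx M) (proj M \<Gamma> A))
        (yon_elem (Ctx M) (Ty M) \<Gamma> A)"

definition bang :: "('o, 'u) nat_model \<Rightarrow> 'o \<Rightarrow> 'u" where
  "bang M \<Gamma> = (THE f. f \<in> Hom (Ctx M) \<Gamma> (emp M))"

text \<open>The sorts of types and of terms are the disjoint unions of the sets $\mathcal{U}(\Gamma)$ and
  $\dot{\mathcal{U}}(\Gamma)$; an element of such a sort is paired with its context.\<close>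

definition types :: "('o, 'u) nat_model \<Rightarrow> ('o \<times> 'u) set" where
  "types M = (SIGMA \<Gamma> : Obj (Ctx M). FObj (Ty M) \<Gamma>)"

definition terms :: "('o, 'u) nat_model \<Rightarrow> ('o \<times> 'u) set" where
  "terms M = (SIGMA \<Gamma> : Obj (Ctx M). FObj (Tm M) \<Gamma>)"

definition type_of :: "('o, 'u) nat_model \<Rightarrow> 'o \<times> 'u \<Rightarrow> 'o \<times> 'u" where
  "type_of M = (\<lambda>(\<Gamma>, a). (\<Gamma>, comp_at (typing M) \<Gamma> a))"

definition ext_ty :: "('o, 'u) nat_model \<Rightarrow> 'o \<times> 'u \<Rightarrow> 'o" where
  "ext_ty M = (\<lambda>(\<Gamma>, A). ext M \<Gamma> A)"

definition proj_ty :: "('o, 'u) nat_model \<Rightarrow> 'o \<times> 'u \<Rightarrow> 'u" where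
  "proj_ty M = (\<lambda>(\<Gamma>, A). proj M \<Gamma> A)"

definition var_ty :: "('o, 'u) nat_model \<Rightarrow> 'o \<times> 'u \<Rightarrow> 'o \<times> 'u" where
  "var_ty M = (\<lambda>(\<Gamma>, A). (ext M \<Gamma> A, var M \<Gamma> A))"

definition subst_tm :: "('o, 'u) nat_model \<Rightarrow> 'o \<times> 'u \<Rightarrow> 'u \<Rightarrow> 'o \<times> 'u" where
  "subst_tm M = (\<lambda>(\<Gamma>, a) \<sigma>. (Dom (Ctx M) \<sigma>, restr (Tm M) \<sigma> a))"

locale unit_type_model = natural_model M
  for M :: "('o, 'u) nat_model" +
  fixes unit star :: "'o \<times> 'u"
  assumes unit_types: "unit \<in> types M"
    and star_terms: "star \<in> terms M"
    and unit_ctx: "fst unit = emp M"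
    and star_ctx: "fst star = emp M"
    and star_type: "type_of M star = unit"
    and proj_unit: "proj_ty M unit = bang M (ext_ty M unit)"
    and var_unit: "var_ty M unit = subst_tm M star (bang M (ext_ty M unit))"

end

theory Submission
  imports Defs
begin

text \<open>
  By the Yoneda lemma, equations (ii) and (iv) say that
  $p \circ \widehat\star = \widehat{\mathbb{1}}$ and
  $\mathsf{q}_{\mathsf{unit}} = \widehat\star \circ \mathsf{y}(\mathsf{p}_{\mathsf{unit}})$,
  while (iii) is automatic because $\diamond$ is terminal. A map into the square with left side
  $\mathrm{id}$ is a pair $(h, k)$ with $p \circ h = \widehat{\mathbb{1}} \circ k$, and the square
  is a pullback iff every such pair satisfies $h = \widehat\star \circ k$. The pullback square of
  $\diamond \cdot \mathsf{unit}$ makes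
  $(\mathsf{q}_{\mathsf{unit}}, \mathsf{y}(\mathsf{p}_{\mathsf{unit}}))$ the universal such pair,
  so this is equivalent to (iv).
\<close>

section \<open>Unfolding rules for opposite, set and functor categories\<close>

lemma HomI: "f \<in> Arr C \<Longrightarrow> Dom C f = X \<Longrightarrow> Cod C f = Y \<Longrightarrow> f \<in> Hom C X Y"
  by (simp add: Hom_def)

lemma op_cat_simps [simp]:
  "Obj (op_cat C) = Obj C" "Arr (op_cat C) = Arr C" "Dom (op_cat C) = Cod C"
  "Cod (op_cat C) = Dom C" "Id (op_cat C) = Id C" "Comp (op_cat C) g f = Comp C f g"
  "Hom (op_cat C) X Y = Hom C Y X"
  by (auto simp: op_cat_def Hom_def)

lemma Set_cat_simps [simp]:
  "Obj Set_cat = UNIV" "Dom Set_cat = src" "Cod Set_cat = trg"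
  "Id Set_cat X = Arrow X (\<lambda>x\<in>X. x) X"
  "Comp Set_cat g f = Arrow (src f) (\<lambda>x\<in>src f. fn g (fn f x)) (trg g)"
  "m \<in> Arr Set_cat \<longleftrightarrow> fn m \<in> src m \<rightarrow>\<^sub>E trg m"
  by (auto simp: Set_cat_def)

lemma functor_cat_simps [simp]:
  "F \<in> Obj (functor_cat A B) \<longleftrightarrow> is_functor A B F"
  "\<eta> \<in> Arr (functor_cat A B) \<longleftrightarrow> is_nat_trans A B \<eta>"
  "Dom (functor_cat A B) = src" "Cod (functor_cat A B) = trg"
  "Id (functor_cat A B) F = Arrow F (\<lambda>X\<in>Obj A. Id B (FObj F X)) F"
  "Comp (functor_cat A B) \<theta> \<eta> = Arrow (src \<eta>) (\<lambda>X\<in>Obj A. Comp B (fn \<theta> X) (fn \<eta> X)) (trg \<theta>)"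
  by (auto simp: functor_cat_def)

section \<open>Category laws, leading to the category of presheaves\<close>

lemma category_op_cat:
  assumes "category C" shows "category (op_cat C)"
proof -
  interpret category C by fact
  show ?thesis
    by unfold_locales (auto simp: Dom_Obj Cod_Obj Id_Hom Comp_Id Id_Comp
        intro: Comp_Hom Comp_assoc[symmetric])
qed

text \<open>Composition restricts the composite to the source, so the identity laws hold on the nose
  because arrows are extensional maps.\<close>

lemma category_Set_cat: "category (Set_cat :: ('u set, ('u set, 'u \<Rightarrow> 'u) arrow) cat)"
proof
  fix X Y Z :: "'u set" and f g :: "('u set, 'u \<Rightarrow> 'u) arrow"
  show "Id Set_cat X \<in> Hom Set_cat X X"
    by (auto simp: Hom_def)
  show "Comp Set_cat g f \<in> Hom Set_cat X Z"
    if "f \<in> Hom Set_cat X Y" "g \<in> Hom Set_cat Y Z"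
    using that by (auto simp: Hom_def PiE_iff)
  show "Comp Set_cat f (Id Set_cat X) = f" if "f \<in> Hom Set_cat X Y"
    using that by (cases f) (auto simp: Hom_def PiE_iff extensional_def fun_eq_iff)
  show "Comp Set_cat (Id Set_cat Y) f = f" if "f \<in> Hom Set_cat X Y"
    using that by (cases f) (auto simp: Hom_def PiE_iff extensional_def fun_eq_iff)
qed (auto simp: Hom_def PiE_iff fun_eq_iff)

text \<open>The laws are inherited componentwise from \<open>B\<close>; components are extensional
  on \<open>Obj A\<close>, so agreement on objects gives equality of transformations.\<close>

lemma category_functor_cat:
  assumes "category A" "category B" shows "category (functor_cat A B)"
proof -
  interpret A: category A by fact
  interpret B: category B by fact
  have obj: "FObj F X \<in> Obj B" if "is_functor A B F" "X \<in> Obj A" for F X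
    using that by (auto simp: is_functor_def)
  have arr: "FArr F f \<in> Hom B (FObj F (Dom A f)) (FObj F (Cod A f))"
    if "is_functor A B F" "f \<in> Arr A" for F f
    using that by (auto simp: is_functor_def)
  have comp: "fn \<eta> X \<in> Hom B (FObj (src \<eta>) X) (FObj (trg \<eta>) X)"
    if "is_nat_trans A B \<eta>" "X \<in> Obj A" for \<eta> X
    using that by (auto simp: is_nat_trans_def)
  have src: "is_functor A B (src \<eta>)" and trg: "is_functor A B (trg \<eta>)"
    and ext: "fn \<eta> \<in> extensional (Obj A)" if "is_nat_trans A B \<eta>" for \<eta>
    using that by (auto simp: is_nat_trans_def)
  have nat: "Comp B (fn \<eta> (Cod A f)) (FArr (src \<eta>) f) = Comp B (FArr (trg \<eta>) f) (fn \<eta> (Dom A f))"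
    if "is_nat_trans A B \<eta>" "f \<in> Arr A" for \<eta> f
    using that by (auto simp: is_nat_trans_def)
  show ?thesis
  proof
    fix F assume F: "F \<in> Obj (functor_cat A B)"
    then show "Id (functor_cat A B) F \<in> Hom (functor_cat A B) F F"
      \<comment> \<open>Both sides of the naturality square of the identity collapse to
        \<open>FArr F f\<close>.\<close>
      using B.Comp_Id[OF arr] B.Id_Comp[OF arr]
      by (auto simp: Hom_def[of "functor_cat A B"] is_nat_trans_def obj B.Id_Hom A.Dom_Obj A.Cod_Obj)
  next
    fix F G H \<eta> \<theta>
    assume "\<eta> \<in> Hom (functor_cat A B) F G" "\<theta> \<in> Hom (functor_cat A B) G H"
    then have \<eta>: "is_nat_trans A B \<eta>" "src \<eta> = F" "trg \<eta> = G"
      and \<theta>: "is_nat_trans A B \<theta>" "src \<theta> = G" "trg \<theta> = H"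
      by (auto simp: Hom_def)
    have "Comp B (Comp B (fn \<theta> (Cod A f)) (fn \<eta> (Cod A f))) (FArr F f) =
        Comp B (FArr H f) (Comp B (fn \<theta> (Dom A f)) (fn \<eta> (Dom A f)))" if f: "f \<in> Arr A" for f
    proof -
      note ob = A.Dom_Obj[OF f] A.Cod_Obj[OF f]
      note e = comp[OF \<eta>(1) ob(1)] comp[OF \<eta>(1) ob(2)] comp[OF \<theta>(1) ob(1)] comp[OF \<theta>(1) ob(2)]
      note e = e[unfolded \<eta> \<theta>]
      note F = arr[OF src[OF \<eta>(1)] f, unfolded \<eta>] and G = arr[OF src[OF \<theta>(1)] f, unfolded \<theta>]
        and H = arr[OF trg[OF \<theta>(1)] f, unfolded \<theta>]
      \<comment> \<open>The naturality squares of \<eta> and \<theta> are pasted along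
        \<open>FArr G f\<close>; the three associativity instances do the rebracketing.\<close>
      show ?thesis
        using nat[OF \<eta>(1) f] nat[OF \<theta>(1) f] B.Comp_assoc[OF F e(2) e(4)]
          B.Comp_assoc[OF e(1) G e(4)] B.Comp_assoc[OF e(1) e(3) H]
        by (simp add: \<eta> \<theta>)
    qed
    moreover have "Comp B (fn \<theta> X) (fn \<eta> X) \<in> Hom B (FObj F X) (FObj H X)" if "X \<in> Obj A" for X
      using B.Comp_Hom comp[OF \<eta>(1) that] comp[OF \<theta>(1) that] by (simp add: \<eta> \<theta>)
    ultimately show "Comp (functor_cat A B) \<theta> \<eta> \<in> Hom (functor_cat A B) F H"
      using src[OF \<eta>(1)] trg[OF \<theta>(1)]
      by (auto simp: Hom_def[of "functor_cat A B"] is_nat_trans_def[of A B "Arrow _ _ _"] \<eta> \<theta>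
          A.Dom_Obj A.Cod_Obj)
  next
    fix F G \<eta>
    assume "\<eta> \<in> Hom (functor_cat A B) F G"
    then have \<eta>: "is_nat_trans A B \<eta>" "src \<eta> = F" "trg \<eta> = G"
      by (auto simp: Hom_def)
    show "Comp (functor_cat A B) \<eta> (Id (functor_cat A B) F) = \<eta>"
      using ext[OF \<eta>(1)] B.Comp_Id[OF comp[OF \<eta>(1)]] \<eta>
      by (intro arrow.expand) (auto simp: fun_eq_iff extensional_def restrict_def)
    show "Comp (functor_cat A B) (Id (functor_cat A B) G) \<eta> = \<eta>"
      using ext[OF \<eta>(1)] B.Id_Comp[OF comp[OF \<eta>(1)]] \<eta>
      by (intro arrow.expand) (auto simp: fun_eq_iff extensional_def restrict_def)
  next
    fix F G H K \<eta> \<theta> \<zeta>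
    assume "\<eta> \<in> Hom (functor_cat A B) F G" "\<theta> \<in> Hom (functor_cat A B) G H"
      "\<zeta> \<in> Hom (functor_cat A B) H K"
    then have \<eta>: "is_nat_trans A B \<eta>" "trg \<eta> = G"
      and \<theta>: "is_nat_trans A B \<theta>" "src \<theta> = G" "trg \<theta> = H"
      and \<zeta>: "is_nat_trans A B \<zeta>" "src \<zeta> = H"
      by (auto simp: Hom_def)
    have "Comp B (Comp B (fn \<zeta> X) (fn \<theta> X)) (fn \<eta> X) = Comp B (fn \<zeta> X) (Comp B (fn \<theta> X) (fn \<eta> X))"
      if "X \<in> Obj A" for X
      using B.Comp_assoc comp[OF \<eta>(1) that] comp[OF \<theta>(1) that] comp[OF \<zeta>(1) that]
      by (metis \<eta>(2) \<theta>(2,3) \<zeta>(2))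
    then show "Comp (functor_cat A B) (Comp (functor_cat A B) \<zeta> \<theta>) \<eta> =
        Comp (functor_cat A B) \<zeta> (Comp (functor_cat A B) \<theta> \<eta>)"
      by (auto simp: fun_eq_iff restrict_def)
  qed (auto intro: src trg)
qed

lemma category_PSh: "category C \<Longrightarrow> category (PSh C)"
  unfolding PSh_def by (intro category_functor_cat category_op_cat category_Set_cat)

lemma PSh_Comp:
  "Comp (PSh C) \<theta> \<eta> =
    Arrow (src \<eta>) (\<lambda>X\<in>Obj C. Comp Set_cat (fn \<theta> X) (fn \<eta> X)) (trg \<theta>)"
  by (simp add: PSh_def)

lemma Obj_PSh_iff: "P \<in> Obj (PSh C) \<longleftrightarrow> is_functor (op_cat C) Set_cat P"
  by (simp add: PSh_def)

lemma Hom_PSh_iff: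
  "\<eta> \<in> Hom (PSh C) P Q \<longleftrightarrow>
    is_nat_trans (op_cat C) Set_cat \<eta> \<and> src \<eta> = P \<and> trg \<eta> = Q"
  by (simp add: Hom_def PSh_def)

lemma Hom_Set_cat_iff: "f \<in> Hom Set_cat X Y \<longleftrightarrow> fn f \<in> X \<rightarrow>\<^sub>E Y \<and> src f = X \<and> trg f = Y"
  by (auto simp: Hom_def)

section \<open>Elements of presheaves and the Yoneda correspondence\<close>

context category
begin

lemma HomD:
  assumes "f \<in> Hom C X Y"
  shows "f \<in> Arr C" "Dom C f = X" "Cod C f = Y" "X \<in> Obj C" "Y \<in> Obj C"
  using assms Dom_Obj Cod_Obj by (auto simp: Hom_def)

lemma presheaf_FArr:
  assumes "P \<in> Obj (PSh C)" "\<sigma> \<in> Hom C \<Delta> \<Gamma>"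
  shows "src (FArr P \<sigma>) = FObj P \<Gamma>" "trg (FArr P \<sigma>) = FObj P \<Delta>"
  using assms by (auto simp: Obj_PSh_iff is_functor_def Hom_Set_cat_iff Hom_def[of C])

lemma restr_mem:
  assumes "P \<in> Obj (PSh C)" "\<sigma> \<in> Hom C \<Delta> \<Gamma>" "x \<in> FObj P \<Gamma>"
  shows "restr P \<sigma> x \<in> FObj P \<Delta>"
  using assms by (auto simp: Obj_PSh_iff is_functor_def restr_def Hom_Set_cat_iff Hom_def[of C])

lemma restr_Id:
  assumes "P \<in> Obj (PSh C)" "\<Gamma> \<in> Obj C" "x \<in> FObj P \<Gamma>"
  shows "restr P (Id C \<Gamma>) x = x"
  using assms by (auto simp: Obj_PSh_iff is_functor_def restr_def)

lemma restr_Comp: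
  assumes "P \<in> Obj (PSh C)" "\<sigma> \<in> Hom C \<Delta> \<Gamma>" "\<tau> \<in> Hom C \<Theta> \<Delta>" "x \<in> FObj P \<Gamma>"
  shows "restr P (Comp C \<sigma> \<tau>) x = restr P \<tau> (restr P \<sigma> x)"
proof -
  have "FArr P (Comp C \<sigma> \<tau>) = Comp Set_cat (FArr P \<tau>) (FArr P \<sigma>)"
    using assms by (auto simp: Obj_PSh_iff is_functor_def Hom_def)
  then show ?thesis
    using presheaf_FArr[OF assms(1,2)] assms(4) by (simp add: restr_def)
qed

lemma comp_at_mem:
  assumes "\<eta> \<in> Hom (PSh C) P Q" "\<Gamma> \<in> Obj C" "x \<in> FObj P \<Gamma>"
  shows "comp_at \<eta> \<Gamma> x \<in> FObj Q \<Gamma>"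
  using assms by (auto simp: Hom_PSh_iff is_nat_trans_def comp_at_def Hom_Set_cat_iff)

lemma restr_comp_at:
  assumes \<eta>: "\<eta> \<in> Hom (PSh C) P Q" and \<sigma>: "\<sigma> \<in> Hom C \<Delta> \<Gamma>" and x: "x \<in> FObj P \<Gamma>"
  shows "restr Q \<sigma> (comp_at \<eta> \<Gamma> x) = comp_at \<eta> \<Delta> (restr P \<sigma> x)"
proof -
  note s = HomD[OF \<sigma>]
  have P: "P \<in> Obj (PSh C)"
    using category.HomD(4)[OF category_PSh[OF category_axioms] \<eta>] .
  \<comment> \<open>In \<open>op_cat C\<close> the arrow \<sigma> runs from \<Gamma> to \<Delta>, so
    this is its naturality square; below it is evaluated at \<open>x\<close>.\<close>
  have "Comp Set_cat (fn \<eta> \<Delta>) (FArr P \<sigma>) = Comp Set_cat (FArr Q \<sigma>) (fn \<eta> \<Gamma>)"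
    using \<eta> s by (auto simp: Hom_PSh_iff is_nat_trans_def)
  moreover have "src (fn \<eta> \<Gamma>) = FObj P \<Gamma>"
    using \<eta> s by (auto simp: Hom_PSh_iff is_nat_trans_def Hom_Set_cat_iff)
  ultimately have "(\<lambda>x\<in>FObj P \<Gamma>. fn (fn \<eta> \<Delta>) (fn (FArr P \<sigma>) x)) =
      (\<lambda>x\<in>FObj P \<Gamma>. fn (FArr Q \<sigma>) (fn (fn \<eta> \<Gamma>) x))"
    using presheaf_FArr[OF P \<sigma>] by simp
  from fun_cong[OF this, of x] x show ?thesis
    by (simp add: restr_def comp_at_def)
qed

text \<open>Precomposition is functorial by associativity and the unit law of
  \<open>C\<close>.\<close>

lemma yon_Obj:
  assumes "\<Gamma> \<in> Obj C"
  shows "yon C \<Gamma> \<in> Obj (PSh C)"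
proof -
  have mem: "Comp C \<tau> \<sigma> \<in> Hom C \<Theta> \<Gamma>" if "\<sigma> \<in> Hom C \<Theta> \<Delta>" "\<tau> \<in> Hom C \<Delta> \<Gamma>" for \<sigma> \<tau> \<Theta> \<Delta>
    using that by (rule Comp_Hom)
  have arr: "FArr (yon C \<Gamma>) \<sigma> \<in> Hom Set_cat (Hom C (Cod C \<sigma>) \<Gamma>) (Hom C (Dom C \<sigma>) \<Gamma>)"
    if "\<sigma> \<in> Arr C" for \<sigma>
    using that mem[of \<sigma> "Dom C \<sigma>" "Cod C \<sigma>"] by (auto simp: yon_def Hom_Set_cat_iff HomI)
  have "FArr (yon C \<Gamma>) (Comp C \<sigma> \<tau>) = Comp Set_cat (FArr (yon C \<Gamma>) \<tau>) (FArr (yon C \<Gamma>) \<sigma>)"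
    if \<sigma>: "\<sigma> \<in> Hom C \<Delta> \<Lambda>" and \<tau>: "\<tau> \<in> Hom C \<Theta> \<Delta>" for \<sigma> \<tau> \<Theta> \<Delta> \<Lambda>
    using HomD[OF \<sigma>] HomD[OF \<tau>] HomD[OF Comp_Hom[OF \<tau> \<sigma>]] mem[OF \<sigma>] Comp_assoc[OF \<tau> \<sigma>]
    by (auto simp: yon_def intro!: restrict_ext)
  \<comment> \<open>Rephrased with \<open>Dom\<close> and \<open>Cod\<close> in place of hom-sets,
    to fit the quantifiers of \<open>is_functor\<close>.\<close>
  then have "FArr (yon C \<Gamma>) (Comp C \<sigma> \<tau>) = Comp Set_cat (FArr (yon C \<Gamma>) \<tau>) (FArr (yon C \<Gamma>) \<sigma>)"
    if "\<sigma> \<in> Arr C" "\<tau> \<in> Arr C" "Cod C \<tau> = Dom C \<sigma>" for \<sigma> \<tau>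
    using that HomI by metis
  moreover have "FArr (yon C \<Gamma>) (Id C \<Delta>) = Id Set_cat (FObj (yon C \<Gamma>) \<Delta>)"
    if "\<Delta> \<in> Obj C" for \<Delta>
    using HomD[OF Id_Hom[OF that]] Comp_Id
    by (auto simp: yon_def intro!: restrict_ext)
  moreover have "FObj (yon C \<Gamma>) \<Delta> = Hom C \<Delta> \<Gamma>" if "\<Delta> \<in> Obj C" for \<Delta>
    using that by (simp add: yon_def)
  moreover have "FObj (yon C \<Gamma>) \<in> extensional (Obj C)" "FArr (yon C \<Gamma>) \<in> extensional (Arr C)"
    by (auto simp: yon_def)
  ultimately show ?thesis
    using arr by (auto simp: Obj_PSh_iff is_functor_def PiE_iff Hom_Set_cat_iff Dom_Obj Cod_Obj)
qed

text \<open>The naturality square at \<sigma>, evaluated at \<tau>, says that restricting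
  \<open>x\<close> along the composite \<open>Comp C \<tau> \<sigma>\<close> is restricting along
  \<tau> and then \<sigma>, which is functoriality of \<open>P\<close>.\<close>

lemma yon_elem_Hom:
  assumes P: "P \<in> Obj (PSh C)" and \<Gamma>: "\<Gamma> \<in> Obj C" and x: "x \<in> FObj P \<Gamma>"
  shows "yon_elem C P \<Gamma> x \<in> Hom (PSh C) (yon C \<Gamma>) P"
proof -
  have "Comp Set_cat (fn (yon_elem C P \<Gamma> x) (Dom C \<sigma>)) (FArr (yon C \<Gamma>) \<sigma>) =
      Comp Set_cat (FArr P \<sigma>) (fn (yon_elem C P \<Gamma> x) (Cod C \<sigma>))" if \<sigma>: "\<sigma> \<in> Arr C" for \<sigma>
  proof -
    have \<sigma>': "\<sigma> \<in> Hom C (Dom C \<sigma>) (Cod C \<sigma>)"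
      using \<sigma> by (simp add: Hom_def)
    have "restr P (Comp C \<tau> \<sigma>) x = fn (FArr P \<sigma>) (restr P \<tau> x)" if "\<tau> \<in> Hom C (Cod C \<sigma>) \<Gamma>" for \<tau>
      using restr_Comp[OF P that \<sigma>' x] by (simp add: restr_def)
    with \<sigma> show ?thesis
      using presheaf_FArr[OF P \<sigma>'] Comp_Hom[OF \<sigma>']
      by (auto simp: yon_elem_def yon_def Dom_Obj Cod_Obj intro!: restrict_ext)
  qed
  moreover have "src (yon_elem C P \<Gamma> x) = yon C \<Gamma>" "trg (yon_elem C P \<Gamma> x) = P"
    "fn (yon_elem C P \<Gamma> x) \<in> extensional (Obj C)"
    by (auto simp: yon_elem_def)
  moreover have "fn (yon_elem C P \<Gamma> x) \<Delta> \<in> Hom Set_cat (FObj (yon C \<Gamma>) \<Delta>) (FObj P \<Delta>)"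
    if "\<Delta> \<in> Obj C" for \<Delta>
    using that restr_mem[OF P _ x] by (auto simp: yon_elem_def yon_def Hom_Set_cat_iff)
  \<comment> \<open>Composition in \<open>Set_cat\<close> is kept folded so that the naturality
    equation proved above applies literally.\<close>
  ultimately show ?thesis
    using yon_Obj[OF \<Gamma>] P by (simp add: Hom_PSh_iff is_nat_trans_def Obj_PSh_iff del: Set_cat_simps(5))
qed

text \<open>Evaluating at the identity of \<Gamma> recovers the element. This lets equations between
  elements be replaced by equations between maps out of representables.\<close>

lemma yon_elem_inject:
  assumes P: "P \<in> Obj (PSh C)" and \<Gamma>: "\<Gamma> \<in> Obj C" and "x \<in> FObj P \<Gamma>" "y \<in> FObj P \<Gamma>"
    and eq: "yon_elem C P \<Gamma> x = yon_elem C P \<Gamma> y"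
  shows "x = y"
proof -
  have "comp_at (yon_elem C P \<Gamma> z) \<Gamma> (Id C \<Gamma>) = z" if "z \<in> FObj P \<Gamma>" for z
    using restr_Id[OF P \<Gamma> that] Id_Hom[OF \<Gamma>] \<Gamma> by (simp add: comp_at_def yon_elem_def)
  then show ?thesis
    using assms by metis
qed

text \<open>Naturality of the Yoneda correspondence in the presheaf: at \<sigma> it is the
  compatibility of \<eta> with restriction along \<sigma>.\<close>

lemma Comp_yon_elem:
  assumes \<eta>: "\<eta> \<in> Hom (PSh C) P Q" and x: "x \<in> FObj P \<Gamma>"
  shows "Comp (PSh C) \<eta> (yon_elem C P \<Gamma> x) = yon_elem C Q \<Gamma> (comp_at \<eta> \<Gamma> x)"
proof -
  \<comment> \<open>Arrows carry their targets, so these must agree as well as the underlying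
    maps.\<close>
  have "trg \<eta> = Q" "\<And>\<Delta>. \<Delta> \<in> Obj C \<Longrightarrow> trg (fn \<eta> \<Delta>) = FObj Q \<Delta>"
    using \<eta> by (auto simp: Hom_PSh_iff is_nat_trans_def Hom_Set_cat_iff)
  then show ?thesis
    using restr_comp_at[OF \<eta> _ x]
    by (auto simp: PSh_Comp yon_elem_def comp_at_def intro!: restrict_ext)
qed

text \<open>Naturality of the Yoneda correspondence in the context: at \<tau> both sides are the
  restriction of \<open>x\<close> along \<open>Comp C \<sigma> \<tau>\<close>.\<close>

lemma yon_elem_restr:
  assumes P: "P \<in> Obj (PSh C)" and \<sigma>: "\<sigma> \<in> Hom C \<Delta> \<Gamma>" and x: "x \<in> FObj P \<Gamma>"
  shows "yon_elem C P \<Delta> (restr P \<sigma> x) = Comp (PSh C) (yon_elem C P \<Gamma> x) (yon_arr C \<sigma>)"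
  using HomD[OF \<sigma>] restr_Comp[OF P \<sigma> _ x] Comp_Hom[OF _ \<sigma>]
  by (auto simp: PSh_Comp yon_elem_def yon_arr_def intro!: restrict_ext)

text \<open>The left leg condition forces the mediating arrow \<open>u\<close> to be
  \<open>k\<close> itself. Unique existence therefore reduces to the other leg condition for
  \<open>k\<close>.\<close>

lemma is_pullback_Id_left_iff:
  assumes t: "t \<in> Hom C X Y" and r: "r \<in> Hom C Y Z" and b: "b \<in> Hom C X Z"
  shows "is_pullback C t r (Id C X) b \<longleftrightarrow>
    Comp C r t = b \<and>
    (\<forall>Q \<in> Obj C. \<forall>h \<in> Hom C Q Y. \<forall>k \<in> Hom C Q X. Comp C r h = Comp C b k \<longrightarrow> Comp C t k = h)"
proof -
  note T = HomD[OF t] and R = HomD[OF r] and B = HomD[OF b]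
    and I = HomD[OF Id_Hom[OF T(4)]]
  have "(\<exists>!u. u \<in> Hom C Q X \<and> Comp C t u = h \<and> Comp C (Id C X) u = k) \<longleftrightarrow> Comp C t k = h"
    if "k \<in> Hom C Q X" for Q h k
    using Id_Comp that by metis
  then show ?thesis
    unfolding is_pullback_def using T R B I Comp_Id[OF b] by auto
qed

end

section \<open>Unit types in a natural model\<close>

context natural_model
begin

interpretation Ctx: category "Ctx M"
  by (rule category_Ctx)

interpretation PSh: category "PSh (Ctx M)"
  by (intro category_PSh category_Ctx)

lemma emp_Obj: "emp M \<in> Obj (Ctx M)"
  using terminal_emp by (simp add: is_terminal_def)

text \<open>Maps into a terminal object are unique, so any given one can replace the definite
  description. For the projection from the context extended by \<open>unit\<close> this is equation
  (iii).\<close>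

lemma bang_eq:
  assumes "\<sigma> \<in> Hom (Ctx M) \<Gamma> (emp M)"
  shows "bang M \<Gamma> = \<sigma>"
proof -
  have "\<exists>!f. f \<in> Hom (Ctx M) \<Gamma> (emp M)"
    using terminal_emp Ctx.HomD(4)[OF assms] by (simp add: is_terminal_def)
  then show ?thesis
    unfolding bang_def using assms by (rule the1_equality)
qed

lemma unit_type_model_iff_pullback:
  assumes one: "one \<in> FObj (Ty M) (emp M)" and pt: "pt \<in> FObj (Tm M) (emp M)"
  shows "unit_type_model M (emp M, one) (emp M, pt) \<longleftrightarrow>
    is_pullback (PSh (Ctx M))
      (yon_elem (Ctx M) (Tm M) (emp M) pt)
      (typing M)
      (Id (PSh (Ctx M)) (yon (Ctx M) (emp M)))
      (yon_elem (Ctx M) (Ty M) (emp M) one)"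
proof -
  let ?E = "ext M (emp M) one" and ?p = "proj M (emp M) one" and ?q = "var M (emp M) one"
  let ?Tm = "yon_elem (Ctx M) (Tm M)" and ?Ty = "yon_elem (Ctx M) (Ty M)"
  let ?yp = "yon_arr (Ctx M) ?p"
  let ?comp = "Comp (PSh (Ctx M))"
  note Ob = PSh.HomD(4,5)[OF typing_Hom]
  note E = ext_Obj[OF emp_Obj one] and p = proj_Hom[OF emp_Obj one]
    and q = var_elem[OF emp_Obj one]
  note tHom = Ctx.yon_elem_Hom[OF Ob(1) emp_Obj pt]
    and bHom = Ctx.yon_elem_Hom[OF Ob(2) emp_Obj one]
    and qHom = Ctx.yon_elem_Hom[OF Ob(1) E q]
  note pb = ext_pullback[OF emp_Obj one, unfolded is_pullback_def]
  \<comment> \<open>That \<open>?yp\<close> is an arrow of presheaves is a clause of the pullback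
    condition; its source and target are read off \<open>yon_arr\<close>.\<close>
  have ypHom: "?yp \<in> Hom (PSh (Ctx M)) (yon (Ctx M) ?E) (yon (Ctx M) (emp M))"
    using pb Ctx.HomD[OF p] by (auto simp: Hom_def PSh_def yon_arr_def)
  have commutes: "?comp (typing M) (?Tm ?E ?q) = ?comp (?Ty (emp M) one) ?yp"
    using pb by blast
  \<comment> \<open>The existence half of the universal property, with the domains of the four
    arrows made explicit.\<close>
  have univ: "\<exists>u. u \<in> Hom (PSh (Ctx M)) Q (yon (Ctx M) ?E) \<and> ?comp (?Tm ?E ?q) u = h \<and> ?comp ?yp u = k"
    if "h \<in> Hom (PSh (Ctx M)) Q (Tm M)" "k \<in> Hom (PSh (Ctx M)) Q (yon (Ctx M) (emp M))"
      "?comp (typing M) h = ?comp (?Ty (emp M) one) k" for Q h k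
    using pb that PSh.HomD(4)[OF that(1)] PSh.HomD(2)[OF typing_Hom] PSh.HomD(2)[OF bHom]
      PSh.HomD(2)[OF qHom]
    by metis
  \<comment> \<open>Both contexts are \<open>emp M\<close> by the form of the pairs, and
    \<open>bang_eq\<close> discharges (iii) and turns the substitution in (iv) into restriction
    along \<open>?p\<close>. Only the typing of \<open>pt\<close> and (iv) remain.\<close>
  have "unit_type_model M (emp M, one) (emp M, pt) \<longleftrightarrow>
      comp_at (typing M) (emp M) pt = one \<and> ?q = restr (Tm M) ?p pt"
    using natural_model_axioms one pt emp_Obj Ctx.HomD(2)[OF p]
    by (auto simp: unit_type_model_def unit_type_model_axioms_def types_def terms_def type_of_def
        ext_ty_def proj_ty_def var_ty_def subst_tm_def bang_eq[OF p])
  \<comment> \<open>This and the next step move the two equations from elements to maps, using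
    naturality and injectivity of the Yoneda correspondence.\<close>
  also have "comp_at (typing M) (emp M) pt = one \<longleftrightarrow>
      ?comp (typing M) (?Tm (emp M) pt) = ?Ty (emp M) one"
    using Ctx.yon_elem_inject[OF Ob(2) emp_Obj Ctx.comp_at_mem[OF typing_Hom emp_Obj pt] one]
    by (auto simp: Ctx.Comp_yon_elem[OF typing_Hom pt])
  also have "?q = restr (Tm M) ?p pt \<longleftrightarrow> ?Tm ?E ?q = ?comp (?Tm (emp M) pt) ?yp"
    using Ctx.yon_elem_inject[OF Ob(1) E q Ctx.restr_mem[OF Ob(1) p pt]]
    by (auto simp flip: Ctx.yon_elem_restr[OF Ob(1) p pt])
  also have "?Tm ?E ?q = ?comp (?Tm (emp M) pt) ?yp \<longleftrightarrow>
      (\<forall>Q \<in> Obj (PSh (Ctx M)). \<forall>h \<in> Hom (PSh (Ctx M)) Q (Tm M).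
        \<forall>k \<in> Hom (PSh (Ctx M)) Q (yon (Ctx M) (emp M)).
        ?comp (typing M) h = ?comp (?Ty (emp M) one) k \<longrightarrow> ?comp (?Tm (emp M) pt) k = h)"
    (is "_ \<longleftrightarrow> ?R")
  proof
    assume eq: "?Tm ?E ?q = ?comp (?Tm (emp M) pt) ?yp"
    show ?R
    proof (intro ballI impI)
      fix Q h k
      assume "h \<in> Hom (PSh (Ctx M)) Q (Tm M)" "k \<in> Hom (PSh (Ctx M)) Q (yon (Ctx M) (emp M))"
        "?comp (typing M) h = ?comp (?Ty (emp M) one) k"
      from univ[OF this] obtain u where u: "u \<in> Hom (PSh (Ctx M)) Q (yon (Ctx M) ?E)"
        "?comp (?Tm ?E ?q) u = h" "?comp ?yp u = k"
        by blast
      \<comment> \<open>With \<open>u\<close> mediating, \<open>h\<close> is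
        \<open>?Tm ?E ?q\<close> after \<open>u\<close>, hence \<open>?Tm (emp M) pt\<close> after
        \<open>?yp\<close> after \<open>u\<close>, and \<open>?yp\<close> after \<open>u\<close> is
        \<open>k\<close>.\<close>
      then show "?comp (?Tm (emp M) pt) k = h"
        using PSh.Comp_assoc[OF u(1) ypHom tHom] eq by simp
    qed
  next
    assume ?R
    \<comment> \<open>The condition is instantiated at the pullback cone itself: \<open>h\<close> is
      \<open>?Tm ?E ?q\<close> and \<open>k\<close> is \<open>?yp\<close>, a compatible pair by
      \<open>commutes\<close>.\<close>
    then show "?Tm ?E ?q = ?comp (?Tm (emp M) pt) ?yp"
      using commutes qHom ypHom PSh.HomD(4)[OF qHom] by metis
  qed
  finally show ?thesis
    by (simp only: PSh.is_pullback_Id_left_iff[OF tHom typing_Hom bHom])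
qed

end

section \<open>The correspondence between the two kinds of structure\<close>

theorem theorem2p2p9:
  shows "bij_betw (\<lambda>(M, unit, star). (M, snd unit, snd star))
    {(M :: ('o, 'u) nat_model, unit, star). unit_type_model M unit star}
    {(M, one, pt). natural_model M \<and>
      one \<in> FObj (Ty M) (emp M) \<and> pt \<in> FObj (Tm M) (emp M) \<and>
      is_pullback (PSh (Ctx M))
        (yon_elem (Ctx M) (Tm M) (emp M) pt)
        (typing M)
        (Id (PSh (Ctx M)) (yon (Ctx M) (emp M)))
        (yon_elem (Ctx M) (Ty M) (emp M) one)}"
proof (rule bij_betw_byWitness[where f' = "\<lambda>(M, one, pt). (M, (emp M, one), (emp M, pt))"])
  \<comment> \<open>Equations (i) and (ii) pin both contexts to \<open>emp M\<close>, so dropping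
    the first components loses nothing and the inverse restores them.\<close>
  have unpack: "natural_model M \<and> unit = (emp M, snd unit) \<and> star = (emp M, snd star) \<and>
      snd unit \<in> FObj (Ty M) (emp M) \<and> snd star \<in> FObj (Tm M) (emp M)"
    if "unit_type_model M unit star" for M :: "('o, 'u) nat_model" and unit star
    using that
    by (cases unit; cases star)
      (auto simp: unit_type_model_def unit_type_model_axioms_def types_def terms_def)
  let ?U = "{(M :: ('o, 'u) nat_model, unit, star). unit_type_model M unit star}"
  show "\<forall>m \<in> ?U. (case case m of (M, unit, star) \<Rightarrow> (M, snd unit, snd star) of
      (M, one, pt) \<Rightarrow> (M, (emp M, one), (emp M, pt))) = m"
    using unpack by fastforce
  show "(\<lambda>(M, unit, star). (M, snd unit, snd star)) ` ?U \<subseteq> {(M, one, pt). natural_model M \<and>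
      one \<in> FObj (Ty M) (emp M) \<and> pt \<in> FObj (Tm M) (emp M) \<and>
      is_pullback (PSh (Ctx M))
        (yon_elem (Ctx M) (Tm M) (emp M) pt)
        (typing M)
        (Id (PSh (Ctx M)) (yon (Ctx M) (emp M)))
        (yon_elem (Ctx M) (Ty M) (emp M) one)}"
    using unpack natural_model.unit_type_model_iff_pullback by fastforce
\<comment> \<open>What is left is that \<open>snd\<close> undoes the pairing with
  \<open>emp M\<close>, and that the inverse lands in the models, which is the converse half of the
  equivalence.\<close>
qed (auto simp: natural_model.unit_type_model_iff_pullback)

end
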